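(* Let $(S,+,\circ)$ be a dual weak brace and let $z\in S$. Then the map $r_z:S\times S\to S\times S$ given by $$r_z(a,b)=\left(-a\circ z+a\circ b\circ z,\ \left(-a\circ z+a\circ b\circ z\right)^{-}\circ a\circ b\right),$$ for all $a,b\in S$, is a set-theoretic solution of the Yang-Baxter equation if and only if $z\in\mathcal{D}_r(S)$.
   Context: An inverse semigroup is a semigroup in which every element $a$ has a unique inverse $a'$ satisfying $a=aa'a$ and $a'=a'aa'$; it is a Clifford semigroup if moreover $aa'=a'a$ for every $a$. A weak (left) brace $(S,+,\circ)$ is a set $S$ with two binary operations such that $(S,+)$ and $(S,\circ)$ are inverse semigroups and, for all $a,b,c\in S$, $a\circ(b+c)=a\circ b-a+a\circ c$ and $a\circ a^-=-a+a$, where $-a$ and $a^-$ denote the inverses of $a$ in $(S,+)$ and $(S,\circ)$, respectively. The operation $+$ need not be commutative; $\circ$ binds more tightly than $+$ and $-$, so $-a\circ z$ means $-(a\circ z)$, and $x-y$ means $x+(-y)$. A weak brace is a dual weak brace if $(S,\circ)$ is a Clifford semigroup. The (right) distributor of $S$ is $\mathcal{D}_r(S)=\{z\in S\mid \forall a,b\in S\ \ (a+b)\circ z=a\circ z-z+b\circ z\}$. A map $r:S\times S\to S\times S$ is a set-theoretic solution of the Yang-Baxter equation if $(r\times\mathrm{id}_S)(\mathrm{id}_S\times r)(r\times\mathrm{id}_S)=(\mathrm{id}_S\times r)(r\times\mathrm{id}_S)(\mathrm{id}_S\times r)$ on $S\times S\times S$ (no bijectivity is required). *)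

theory Defs
  imports Main
begin

text \<open>The underlying set of every structure is a whole type. In the weak brace, \<open>\<oplus>\<close> and \<open>\<odot>\<close>
  stand for the operations usually written \<open>+\<close> and \<open>\<circ>\<close>.\<close>

locale inverse_semigroup = semigroup f
  for f :: "'a \<Rightarrow> 'a \<Rightarrow> 'a" (infixl \<open>\<^bold>*\<close> 70) +
  assumes ex1_inverse: "\<exists>!x. a = a \<^bold>* x \<^bold>* a \<and> x = x \<^bold>* a \<^bold>* x"
begin

definition inv_of :: "'a \<Rightarrow> 'a"
  where "inv_of a = (THE x. a = a \<^bold>* x \<^bold>* a \<and> x = x \<^bold>* a \<^bold>* x)"

end

locale clifford_semigroup = inverse_semigroup +
  assumes inv_of_commutes: "a \<^bold>* inv_of a = inv_of a \<^bold>* a"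

locale weak_brace =
  add: inverse_semigroup add + mul: inverse_semigroup mul
  for add :: "'a \<Rightarrow> 'a \<Rightarrow> 'a" (infixl \<open>\<oplus>\<close> 65)
    and mul :: "'a \<Rightarrow> 'a \<Rightarrow> 'a" (infixl \<open>\<odot>\<close> 70) +
  assumes brace_distrib: "a \<odot> (b \<oplus> c) = a \<odot> b \<oplus> add.inv_of a \<oplus> a \<odot> c"
    and brace_idem: "a \<odot> mul.inv_of a = add.inv_of a \<oplus> a"
begin

definition right_distributor :: "'a set"
  where "right_distributor = {z. \<forall>a b. (a \<oplus> b) \<odot> z = a \<odot> z \<oplus> add.inv_of z \<oplus> b \<odot> z}"

definition deformed_map :: "'a \<Rightarrow> 'a \<times> 'a \<Rightarrow> 'a \<times> 'a"
  where "deformed_map z = (\<lambda>(a, b).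
    (add.inv_of (a \<odot> z) \<oplus> a \<odot> b \<odot> z,
     mul.inv_of (add.inv_of (a \<odot> z) \<oplus> a \<odot> b \<odot> z) \<odot> a \<odot> b))"

end

locale dual_weak_brace = weak_brace + mul: clifford_semigroup mul

text \<open>Triples are right-nested pairs, so \<open>r \<times> id\<close> has to reassociate its argument and
  result.\<close>

definition times_id :: "('a \<times> 'a \<Rightarrow> 'a \<times> 'a) \<Rightarrow> 'a \<times> 'a \<times> 'a \<Rightarrow> 'a \<times> 'a \<times> 'a"
  where "times_id r = (\<lambda>(a, b, c). case r (a, b) of (x, y) \<Rightarrow> (x, y, c))"

definition id_times :: "('a \<times> 'a \<Rightarrow> 'a \<times> 'a) \<Rightarrow> 'a \<times> 'a \<times> 'a \<Rightarrow> 'a \<times> 'a \<times> 'a"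
  where "id_times r = map_prod id r"

definition yang_baxter_solution :: "('a \<times> 'a \<Rightarrow> 'a \<times> 'a) \<Rightarrow> bool"
  where "yang_baxter_solution r \<longleftrightarrow>
    times_id r \<circ> id_times r \<circ> times_id r = id_times r \<circ> times_id r \<circ> id_times r"

end

theory Submission
  imports Defs
begin

text \<open>The idempotents of \<open>\<oplus>\<close> and \<open>\<odot>\<close> coincide, are central for both operations, and multiplication by an
  idempotent \<open>e\<close> is an endomorphism of the whole structure. Hence \<open>S\<close> is a semilattice of skew
  braces, indexed by \<open>src a = a \<odot> a\<^sup>-\<close>, and an identity between terms containing the same variables
  may be checked inside one skew brace, where all variables have the same \<open>src\<close>.

  There, write \<open>r\<^sub>z(a, b) = (\<sigma>\<^sub>a b, \<tau>\<^sub>b a)\<close>. One has \<open>\<sigma>\<^sub>a b \<odot> \<tau>\<^sub>b a = a \<odot> b\<close> and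
  \<open>\<sigma>\<^sub>a b \<odot> \<sigma>\<^bsub>\<tau>\<^sub>b a\<^esub> c = \<sigma>\<^sub>a (b \<odot> c)\<close>, so that the Yang-Baxter equation amounts to its first
  component \<open>\<sigma>\<^sub>u (\<sigma>\<^sub>v c) = \<sigma>\<^sub>a (\<sigma>\<^sub>b c)\<close> with \<open>(u, v) = r\<^sub>z(a, b)\<close>. If \<open>z\<close> is a distributor element,
  \<open>\<sigma>\<^sub>a (\<sigma>\<^sub>b c)\<close> depends on \<open>a \<odot> b\<close> and \<open>c\<close> only. Conversely, the case where \<open>b\<close> is the neutral
  element says that \<open>\<sigma>\<^sub>1\<close> and \<open>\<sigma>\<^sub>a\<close> commute, and this unfolds to the distributor identity.\<close>

section \<open>Inverse semigroups: commuting idempotents\<close>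

context inverse_semigroup
begin

lemma inv_of_inverse: "a = a \<^bold>* inv_of a \<^bold>* a \<and> inv_of a = inv_of a \<^bold>* a \<^bold>* inv_of a"
  unfolding inv_of_def by (rule theI'[OF ex1_inverse])

lemma mult_inv_mult: "a \<^bold>* (inv_of a \<^bold>* a) = a"
  using inv_of_inverse[of a] by (metis assoc)

lemma inv_mult_inv: "inv_of a \<^bold>* (a \<^bold>* inv_of a) = inv_of a"
  using inv_of_inverse[of a] by (metis assoc)

lemma inv_of_eqI:
  assumes "a \<^bold>* (x \<^bold>* a) = a" "x \<^bold>* (a \<^bold>* x) = x"
  shows "inv_of a = x"
  using ex1_inverse[of a] inv_of_inverse[of a] assms by (metis assoc)

lemma inv_of_inv_of [simp]: "inv_of (inv_of a) = a"
  by (rule inv_of_eqI) (simp_all add: mult_inv_mult inv_mult_inv)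

lemma inv_of_idem: "e \<^bold>* e = e \<Longrightarrow> inv_of e = e"
  by (rule inv_of_eqI) simp_all

lemma idem_mult:
  assumes e: "e \<^bold>* e = e" and h: "h \<^bold>* h = h"
  shows "(e \<^bold>* h) \<^bold>* (e \<^bold>* h) = e \<^bold>* h"
proof -
  define x where "x = inv_of (e \<^bold>* h)"
  have e': "e \<^bold>* (e \<^bold>* y) = e \<^bold>* y" and h': "h \<^bold>* (h \<^bold>* y) = h \<^bold>* y" for y
    using e h by (simp_all flip: assoc)
  have 1: "e \<^bold>* (h \<^bold>* (x \<^bold>* (e \<^bold>* h))) = e \<^bold>* h"
    using mult_inv_mult[of "e \<^bold>* h"] by (simp add: x_def assoc)
  have 2: "x \<^bold>* (e \<^bold>* (h \<^bold>* x)) = x"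
    using inv_mult_inv[of "e \<^bold>* h"] by (simp add: x_def assoc)
  have cancel: "x \<^bold>* (e \<^bold>* (h \<^bold>* (x \<^bold>* y))) = x \<^bold>* y" for y
    using arg_cong[OF 2, of "\<lambda>t. t \<^bold>* y"] by (simp add: assoc)
  have "inv_of (e \<^bold>* h) = h \<^bold>* (x \<^bold>* e)"
    by (rule inv_of_eqI) (simp_all add: assoc e' h' 1 cancel)
  then have x: "x = h \<^bold>* (x \<^bold>* e)" by (simp add: x_def)
  have "x \<^bold>* x = h \<^bold>* (x \<^bold>* (e \<^bold>* (h \<^bold>* (x \<^bold>* e))))"
    by (subst (1 2) x) (simp add: assoc)
  also have "\<dots> = x" unfolding cancel by (rule x[symmetric])
  finally have "x \<^bold>* x = x" .
  then have "inv_of x = x" by (rule inv_of_idem)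
  then have "x = e \<^bold>* h" by (simp add: x_def)
  with \<open>x \<^bold>* x = x\<close> show ?thesis by simp
qed

lemma idem_commute:
  assumes e: "e \<^bold>* e = e" and h: "h \<^bold>* h = h"
  shows "e \<^bold>* h = h \<^bold>* e"
proof -
  have e': "e \<^bold>* (e \<^bold>* y) = e \<^bold>* y" and h': "h \<^bold>* (h \<^bold>* y) = h \<^bold>* y" for y
    using e h by (simp_all flip: assoc)
  have "inv_of (e \<^bold>* h) = h \<^bold>* e"
    by (rule inv_of_eqI)
      (use idem_mult[OF e h] idem_mult[OF h e] in \<open>simp_all add: assoc e' h'\<close>)
  then show ?thesis
    using inv_of_idem[OF idem_mult[OF e h]] by simp
qed

lemma idem_mult_inv: "(a \<^bold>* inv_of a) \<^bold>* (a \<^bold>* inv_of a) = a \<^bold>* inv_of a"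
  by (simp add: assoc inv_mult_inv)

lemma idem_inv_mult: "(inv_of a \<^bold>* a) \<^bold>* (inv_of a \<^bold>* a) = inv_of a \<^bold>* a"
  by (simp add: assoc mult_inv_mult)

lemma inv_of_mult [simp]: "inv_of (a \<^bold>* b) = inv_of b \<^bold>* inv_of a"
proof (rule inv_of_eqI)
  note comm = idem_commute[OF idem_mult_inv[of b] idem_inv_mult[of a]]
  have "a \<^bold>* b \<^bold>* (inv_of b \<^bold>* inv_of a \<^bold>* (a \<^bold>* b))
      = a \<^bold>* ((b \<^bold>* inv_of b) \<^bold>* (inv_of a \<^bold>* a)) \<^bold>* b"
    by (simp add: assoc)
  also have "\<dots> = (a \<^bold>* (inv_of a \<^bold>* a)) \<^bold>* (b \<^bold>* (inv_of b \<^bold>* b))"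
    unfolding comm by (simp only: assoc)
  finally show "a \<^bold>* b \<^bold>* (inv_of b \<^bold>* inv_of a \<^bold>* (a \<^bold>* b)) = a \<^bold>* b"
    by (simp add: mult_inv_mult)
  have "inv_of b \<^bold>* inv_of a \<^bold>* (a \<^bold>* b \<^bold>* (inv_of b \<^bold>* inv_of a))
      = inv_of b \<^bold>* ((inv_of a \<^bold>* a) \<^bold>* (b \<^bold>* inv_of b)) \<^bold>* inv_of a"
    by (simp add: assoc)
  also have "\<dots> = (inv_of b \<^bold>* (b \<^bold>* inv_of b)) \<^bold>* (inv_of a \<^bold>* (a \<^bold>* inv_of a))"
    unfolding comm[symmetric] by (simp only: assoc)
  finally show "inv_of b \<^bold>* inv_of a \<^bold>* (a \<^bold>* b \<^bold>* (inv_of b \<^bold>* inv_of a)) = inv_of b \<^bold>* inv_of a"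
    by (simp add: inv_mult_inv)
qed

end

section \<open>Clifford semigroups: central idempotents\<close>

context clifford_semigroup
begin

text \<open>This is the identity of the maximal subgroup containing \<open>a\<close>; elements of
  equal \<open>src\<close> form a group.\<close>

definition src :: "'a \<Rightarrow> 'a"
  where "src a = a \<^bold>* inv_of a"

lemma mult_inv_of [simp]: "a \<^bold>* inv_of a = src a"
  by (simp add: src_def)

lemma inv_of_mult_self [simp]: "inv_of a \<^bold>* a = src a"
  by (simp flip: inv_of_commutes)

lemma src_idem [simp]: "src a \<^bold>* src a = src a"
  using idem_mult_inv[of a] by simp

lemma mult_src [simp]: "a \<^bold>* src a = a"
  using mult_inv_mult[of a] by simp

lemma src_mult_self [simp]: "src a \<^bold>* a = a"
  by (metis assoc mult_inv_mult mult_inv_of)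

lemma src_inv_of [simp]: "src (inv_of a) = src a"
  by (metis inv_of_inv_of inv_of_mult_self mult_inv_of)

lemma src_of_idem: "e \<^bold>* e = e \<Longrightarrow> src e = e"
  unfolding src_def by (simp add: inv_of_idem del: mult_inv_of)

lemma src_src [simp]: "src (src a) = src a"
  by (simp add: src_of_idem)

lemma inv_of_src [simp]: "inv_of (src a) = src a"
  by (simp add: inv_of_idem)

lemma src_commute: "src a \<^bold>* x = x \<^bold>* src a"
proof -
  let ?e = "src a"
  have "(?e \<^bold>* x) \<^bold>* inv_of (?e \<^bold>* x) = ?e \<^bold>* (src x \<^bold>* ?e)"
    by (metis assoc inv_of_mult inv_of_src mult_inv_of)
  also have "\<dots> = ?e \<^bold>* src x"
    by (metis assoc idem_commute src_idem)
  finally have l: "(?e \<^bold>* x) \<^bold>* inv_of (?e \<^bold>* x) = ?e \<^bold>* src x" .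
  have "inv_of (?e \<^bold>* x) \<^bold>* (?e \<^bold>* x) = inv_of x \<^bold>* (?e \<^bold>* x)"
    by (metis assoc inv_of_mult inv_of_src src_idem)
  then have c: "inv_of x \<^bold>* (?e \<^bold>* x) = ?e \<^bold>* src x"
    using l by (metis inv_of_commutes)
  have "?e \<^bold>* x = ?e \<^bold>* src x \<^bold>* x"
    by (simp only: assoc src_mult_self)
  also have "\<dots> = x \<^bold>* (inv_of x \<^bold>* (?e \<^bold>* x))"
    by (metis assoc idem_commute mult_inv_of src_idem)
  also have "\<dots> = x \<^bold>* (src x \<^bold>* ?e)"
    unfolding c by (metis idem_commute src_idem)
  also have "\<dots> = x \<^bold>* ?e"
    by (metis assoc mult_src)
  finally show ?thesis .
qed

lemma src_ac:
  "src a \<^bold>* src b = src b \<^bold>* src a"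
  "src a \<^bold>* (src b \<^bold>* x) = src b \<^bold>* (src a \<^bold>* x)"
  "src a \<^bold>* (src a \<^bold>* x) = src a \<^bold>* x"
  by (rule src_commute, metis assoc src_commute, metis assoc src_idem)

lemma src_mult [simp]: "src (a \<^bold>* b) = src a \<^bold>* src b"
proof -
  have "src (a \<^bold>* b) = a \<^bold>* (src b \<^bold>* inv_of a)"
    by (metis assoc inv_of_mult mult_inv_of)
  also have "\<dots> = src a \<^bold>* src b"
    unfolding src_commute[of b] by (simp flip: assoc)
  finally show ?thesis .
qed

lemma neutral_left: "src x = e \<Longrightarrow> e \<^bold>* x = x"
  and neutral_right: "src x = e \<Longrightarrow> x \<^bold>* e = x"
  using src_mult_self mult_src by blast+

lemma cancel_left:
  assumes "src x = src y"
  shows "x \<^bold>* (inv_of x \<^bold>* y) = y" and "inv_of x \<^bold>* (x \<^bold>* y) = y"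
  using assms by (simp_all flip: assoc)

end

section \<open>Idempotents of a dual weak brace\<close>

context dual_weak_brace
begin

notation add.inv_of (\<open>\<ominus> _\<close> [81] 80)
notation mul.inv_of (\<open>_\<^sup>-\<close> [1000] 999)

lemma neg_add_self: "\<ominus> a \<oplus> a = mul.src a"
  using brace_idem[of a] by simp

lemma add_idem_iff: "e \<oplus> e = e \<longleftrightarrow> mul.src e = e"
  by (metis add.idem_inv_mult add.inv_of_idem neg_add_self)

lemma idem_add_idem: "mul.src e \<oplus> mul.src e = mul.src e"
  by (simp add: add_idem_iff)

lemma neg_src: "\<ominus> mul.src e = mul.src e"
  by (simp add: add.inv_of_idem idem_add_idem)

lemma src_mul_add': "mul.src e \<odot> (b \<oplus> c) = mul.src e \<odot> b \<oplus> mul.src e \<oplus> mul.src e \<odot> c"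
  by (simp add: brace_distrib neg_src)

text \<open>Comparing both bracketings of \<open>e \<odot> f \<odot> (e \<oplus> f)\<close> gives \<open>e \<oplus> e \<odot> f = e \<odot> f\<close>.\<close>

lemma src_add_src: "mul.src a \<oplus> mul.src b = mul.src a \<odot> mul.src b"
proof -
  define e f g p where "e = mul.src a" and "f = mul.src b" and "g = e \<odot> f" and "p = e \<oplus> f"
  have se: "mul.src e = e" and sf: "mul.src f = f" and sg: "mul.src g = g"
    by (simp_all add: e_def f_def g_def)
  have fe: "f \<odot> e = g" unfolding g_def using mul.src_commute[of a f] by (simp add: e_def)
  have ee: "e \<odot> e = e" and ff: "f \<odot> f = f" by (simp_all add: e_def f_def)
  have eg: "e \<odot> g = g" using ee by (simp add: g_def flip: mul.assoc)
  have fg: "f \<odot> g = g" using ff by (simp add: fe[symmetric] flip: mul.assoc)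
  have add_e: "e \<oplus> e = e" and add_f: "f \<oplus> f = f" and add_g: "g \<oplus> g = g"
    using se sf sg by (simp_all add: add_idem_iff)
  have comm: "x \<oplus> y = y \<oplus> x" if "x \<oplus> x = x" "y \<oplus> y = y" for x y
    using that by (rule add.idem_commute)
  have add_p: "p \<oplus> p = p"
    unfolding p_def using add_e add_f by (rule add.idem_mult)
  then have sp: "mul.src p = p" by (simp add: add_idem_iff)
  have E: "e \<odot> (x \<oplus> y) = e \<odot> x \<oplus> e \<oplus> e \<odot> y" for x y
    using src_mul_add'[of a x y] by (simp add: e_def)
  have F: "f \<odot> (x \<oplus> y) = f \<odot> x \<oplus> f \<oplus> f \<odot> y" for x y
    using src_mul_add'[of b x y] by (simp add: f_def)
  have G: "g \<odot> (x \<oplus> y) = g \<odot> x \<oplus> g \<oplus> g \<odot> y" for x y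
    using src_mul_add'[of g x y] by (simp add: sg)
  have P: "p \<odot> (x \<oplus> y) = p \<odot> x \<oplus> p \<oplus> p \<odot> y" for x y
    using src_mul_add'[of p x y] by (simp add: sp)
  have ge: "g \<odot> e = g" and gf: "g \<odot> f = g"
    using ee ff by (simp_all add: g_def mul.assoc fe[unfolded g_def])
      (simp_all add: fe g_def flip: mul.assoc)
  have gp: "g \<odot> p = g" unfolding p_def by (simp add: G ge gf add_g)
  have ep: "e \<odot> p = e \<oplus> g" unfolding p_def by (simp add: E ee add_e g_def[symmetric])
  have fp: "f \<odot> p = g \<oplus> f" unfolding p_def by (simp add: F ff add_f fe add.assoc)
  have "g = e \<odot> (f \<odot> p)" using gp by (simp add: g_def mul.assoc)
  also have "\<dots> = g \<oplus> e \<oplus> g" by (simp add: fp E eg g_def[symmetric])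
  also have "\<dots> = e \<oplus> g" by (metis add.assoc comm add_e add_g)
  finally have 1: "e \<oplus> g = g" by simp
  have "g = f \<odot> (e \<odot> p)" using gp by (simp add: fe[symmetric] mul.assoc)
  also have "\<dots> = g \<oplus> f \<oplus> g" by (simp add: ep F fg fe)
  also have "\<dots> = g \<oplus> f" by (metis add.assoc comm add_f add_g)
  finally have 2: "g \<oplus> f = g" by simp
  have pe: "p \<odot> e = g" using ep 1 mul.src_commute[of a p] by (simp add: e_def)
  have pf: "p \<odot> f = g" using fp 2 mul.src_commute[of b p] by (simp add: f_def)
  \<comment> \<open>Expanding one factor of \<open>p \<odot> p\<close> as
    \<open>e \<oplus> f\<close> leaves \<open>g \<oplus> p \<oplus> g\<close>, and \<open>g\<close>
    absorbs \<open>p\<close>.\<close>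
  have "p = p \<odot> p" by (metis sp mul.src_idem)
  also have "\<dots> = p \<odot> (e \<oplus> f)" by (simp add: p_def)
  also have "\<dots> = g \<oplus> p \<oplus> g" by (simp add: P pe pf)
  also have "\<dots> = g" by (metis 1 2 add.assoc comm add_g add_p p_def)
  finally show ?thesis by (simp add: p_def g_def e_def f_def)
qed

text \<open>The extra middle summand is absorbed on the right by \<open>mul.src e \<odot> b\<close>,
  because the additive right identity of that element is
  \<open>mul.src b \<oplus> mul.src e\<close>.\<close>

lemma src_mul_add: "mul.src e \<odot> (b \<oplus> c) = mul.src e \<odot> b \<oplus> mul.src e \<odot> c"
proof -
  let ?x = "mul.src e \<odot> b"
  have "?x \<oplus> mul.src ?x = ?x"
    using add.mult_inv_mult[of ?x] by (simp add: neg_add_self)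
  then have "?x \<oplus> (mul.src b \<oplus> mul.src e) = ?x"
    by (simp add: src_add_src mul.src_ac)
  then have "?x \<oplus> mul.src e = ?x"
    by (metis add.assoc idem_add_idem)
  then show ?thesis by (simp add: src_mul_add')
qed

text \<open>The additive left identity \<open>?f\<close> of \<open>?x\<close> is not yet known to be
  \<open>mul.src ?x\<close>. Multiplying \<open>?x = ?f \<oplus> ?x\<close> by
  \<open>mul.src e\<close> turns \<open>?f\<close> into \<open>mul.src e \<oplus> ?f\<close>, which
  exposes the desired summand.\<close>

lemma src_add_src_mul: "mul.src e \<oplus> mul.src e \<odot> b = mul.src e \<odot> b"
proof -
  let ?x = "mul.src e \<odot> b" and ?f = "mul.src (\<ominus> (mul.src e \<odot> b))"
  have f: "?f = ?x \<oplus> \<ominus> ?x"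
    using neg_add_self[of "\<ominus> ?x"] by simp
  have fx: "?f \<oplus> ?x = ?x"
    unfolding f by (simp add: add.assoc add.mult_inv_mult)
  have ex: "mul.src e \<odot> ?x = ?x" by (simp flip: mul.assoc)
  have "?x = mul.src e \<odot> (?f \<oplus> ?x)" by (simp only: fx ex)
  also have "\<dots> = mul.src e \<odot> ?f \<oplus> ?x" by (simp only: src_mul_add ex)
  also have "\<dots> = mul.src e \<oplus> ?x" by (simp only: src_add_src[symmetric] add.assoc fx)
  finally show ?thesis by simp
qed

lemma src_neg: "mul.src (\<ominus> a) = mul.src a"
proof -
  have le: "mul.src b \<odot> mul.src (\<ominus> b) = mul.src (\<ominus> b)" for b
  proof -
    have "mul.src b \<oplus> b = b" using src_add_src_mul[of b b] by simp
    moreover have "mul.src (\<ominus> b) = b \<oplus> \<ominus> b" using neg_add_self[of "\<ominus> b"] by simp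
    ultimately show ?thesis by (metis add.assoc src_add_src)
  qed
  show ?thesis using le[of a] le[of "\<ominus> a"] by (metis add.inv_of_inv_of mul.src_commute)
qed

text \<open>The two sides are \<open>mul.src (\<ominus> a)\<close> and \<open>mul.src a\<close>,
  which agree. From here on both operations share one source map.\<close>

sublocale add: clifford_semigroup add
proof
  show "a \<oplus> \<ominus> a = \<ominus> a \<oplus> a" for a
    using neg_add_self[of a] neg_add_self[of "\<ominus> a"] by (simp add: src_neg)
qed

lemma add_src_eq [simp]: "add.src a = mul.src a"
  using neg_add_self[of a] by simp

declare src_neg [simp]

lemma src_add [simp]: "mul.src (a \<oplus> b) = mul.src a \<odot> mul.src b"
  using add.src_mult[of a b] by (simp only: add_src_eq src_add_src)

text \<open>The source of the sum lies below \<open>mul.src e\<close>, so multiplying the sum by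
  \<open>mul.src e\<close> changes nothing; distributing that factor gives the product.\<close>

lemma src_add_eq_mul: "mul.src e \<oplus> b = mul.src e \<odot> b"
proof -
  let ?y = "mul.src e \<oplus> b"
  have "mul.src e \<odot> ?y = mul.src e \<odot> (mul.src ?y \<odot> ?y)"
    by (simp only: mul.src_mult_self)
  also have "\<dots> = mul.src ?y \<odot> ?y"
    by (simp del: mul.src_mult_self flip: mul.assoc)
  also have "\<dots> = ?y" by (simp only: mul.src_mult_self)
  finally have "?y = mul.src e \<odot> ?y" by simp
  also have "\<dots> = mul.src e \<odot> b"
    by (simp add: src_mul_add src_add_src_mul)
  finally show ?thesis .
qed

lemma src_mul_mul: "mul.src e \<odot> (x \<odot> y) = (mul.src e \<odot> x) \<odot> (mul.src e \<odot> y)"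
  by (metis mul.assoc mul.src_commute mul.src_idem)

lemma src_mul_neg: "mul.src e \<odot> \<ominus> x = \<ominus> (mul.src e \<odot> x)"
  by (metis add.inv_of_mult add.src_commute add_src_eq mul.src_src neg_src src_add_eq_mul)

lemma src_mul_inv: "mul.src e \<odot> x\<^sup>- = (mul.src e \<odot> x)\<^sup>-"
  by (simp add: mul.src_commute[of e])

section \<open>Components of the deformed map and their projections\<close>

definition sigma :: "'a \<Rightarrow> 'a \<Rightarrow> 'a \<Rightarrow> 'a"
  where "sigma z a b = \<ominus> (a \<odot> z) \<oplus> a \<odot> b \<odot> z"

definition tau :: "'a \<Rightarrow> 'a \<Rightarrow> 'a \<Rightarrow> 'a"
  where "tau z b a = (sigma z a b)\<^sup>- \<odot> a \<odot> b"

lemma deformed_map_eq: "deformed_map z (a, b) = (sigma z a b, tau z b a)"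
  by (simp add: deformed_map_def sigma_def tau_def)

lemma yang_baxter_deformed_map_iff:
  "yang_baxter_solution (deformed_map z) \<longleftrightarrow>
    (\<forall>a b c.
      sigma z (sigma z a b) (sigma z (tau z b a) c) = sigma z a (sigma z b c) \<and>
      tau z (sigma z (tau z b a) c) (sigma z a b) =
        sigma z (tau z (sigma z b c) a) (tau z c b) \<and>
      tau z c (tau z b a) = tau z (tau z c b) (tau z (sigma z b c) a))"
  by (simp add: yang_baxter_solution_def fun_eq_iff times_id_def id_times_def deformed_map_eq)

lemma src_sigma [simp]:
  "mul.src (sigma z a b) = mul.src a \<odot> mul.src b \<odot> mul.src z"
  unfolding sigma_def by (simp add: mul.assoc mul.src_ac)

lemma src_tau [simp]:
  "mul.src (tau z b a) = mul.src a \<odot> mul.src b \<odot> mul.src z"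
  unfolding tau_def by (simp add: mul.assoc mul.src_ac)

lemma src_mul_sigma:
  "mul.src e \<odot> sigma z a b = sigma (mul.src e \<odot> z) (mul.src e \<odot> a) (mul.src e \<odot> b)"
  unfolding sigma_def by (simp only: src_mul_add src_mul_neg src_mul_mul)

lemma src_mul_tau:
  "mul.src e \<odot> tau z b a = tau (mul.src e \<odot> z) (mul.src e \<odot> b) (mul.src e \<odot> a)"
  unfolding tau_def by (simp only: src_mul_sigma src_mul_inv src_mul_mul)

text \<open>Projecting to one skew brace replaces \<open>z\<close> by its multiple by an idempotent,
  so membership has to survive this.\<close>

lemma src_mul_right_distributor:
  assumes "z \<in> right_distributor"
  shows "mul.src e \<odot> z \<in> right_distributor"
proof -
  have "(a \<oplus> b) \<odot> (mul.src e \<odot> z) =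
      a \<odot> (mul.src e \<odot> z) \<oplus> \<ominus> (mul.src e \<odot> z) \<oplus> b \<odot> (mul.src e \<odot> z)" for a b
  proof -
    have "x \<odot> (mul.src e \<odot> z) = mul.src e \<odot> (x \<odot> z)" for x
      by (metis mul.assoc mul.src_commute)
    then show ?thesis
      using assms by (simp add: right_distributor_def src_mul_add src_mul_neg)
  qed
  then show ?thesis by (simp add: right_distributor_def)
qed

section \<open>Computations inside one skew brace\<close>

text \<open>The elements \<open>x\<close> with \<open>src x = e\<close> form a skew brace with neutral element \<open>e\<close>.\<close>

context
  fixes e :: 'a
  assumes ee: "e \<odot> e = e"
begin

lemma e_add: "mul.src x = e \<Longrightarrow> e \<oplus> x = x"
  and add_e: "mul.src x = e \<Longrightarrow> x \<oplus> e = x"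
  by (simp_all add: add.neutral_left add.neutral_right)

lemma mul_neg:
  assumes "mul.src a = e" "mul.src b = e"
  shows "a \<odot> \<ominus> b = a \<oplus> (\<ominus> (a \<odot> b) \<oplus> a)"
proof -
  have "a = a \<odot> (b \<oplus> \<ominus> b)" using assms by (simp add: mul.neutral_right)
  also have "\<dots> = a \<odot> b \<oplus> (\<ominus> a \<oplus> a \<odot> \<ominus> b)" by (simp add: brace_distrib add.assoc del: add.mult_inv_of)
  finally have "\<ominus> (a \<odot> b) \<oplus> a = \<ominus> (a \<odot> b) \<oplus> (a \<odot> b \<oplus> (\<ominus> a \<oplus> a \<odot> \<ominus> b))" by simp
  also have "\<dots> = \<ominus> a \<oplus> a \<odot> \<ominus> b" by (rule add.cancel_left) (simp add: assms ee)
  finally show ?thesis by (simp add: add.cancel_left assms ee)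
qed

lemmas skew_brace_simps = ee add.assoc mul.assoc brace_distrib mul_neg e_add add_e
  mul.neutral_left mul.neutral_right add.cancel_left mul.cancel_left

lemma sigma_neutral:
  assumes "mul.src a = e" "mul.src z = e"
  shows "sigma z a e = e"
  unfolding sigma_def by (simp add: skew_brace_simps assms)

lemma tau_neutral:
  assumes "mul.src a = e" "mul.src z = e"
  shows "tau z e a = a"
proof -
  have "e\<^sup>- = e" using ee by (rule mul.inv_of_idem)
  then show ?thesis
    unfolding tau_def sigma_neutral[OF assms] by (simp add: skew_brace_simps assms)
qed

lemma sigma_mul_tau:
  assumes "mul.src a = e" "mul.src b = e" "mul.src z = e"
  shows "sigma z a b \<odot> tau z b a = a \<odot> b"
  by (simp add: tau_def skew_brace_simps assms)

text \<open>Distributing \<open>u\<close> over \<open>sigma z v c\<close> and using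
  \<open>u \<odot> v = a \<odot> b\<close> gives \<open>u \<oplus> (\<ominus> (a \<odot> b \<odot>
  z) \<oplus> a \<odot> b \<odot> c \<odot> z)\<close>; inserting \<open>u = sigma z a b\<close>
  makes the sum telescope.\<close>

lemma sigma_mul_sigma:
  assumes "mul.src a = e" "mul.src b = e" "mul.src c = e" "mul.src z = e"
    "mul.src u = e" "mul.src v = e" and uv: "u = sigma z a b" "u \<odot> v = a \<odot> b"
  shows "u \<odot> sigma z v c = sigma z a (b \<odot> c)"
proof -
  have uv': "u \<odot> (v \<odot> x) = a \<odot> (b \<odot> x)" for x
    using uv(2) by (simp flip: mul.assoc)
  have "u \<odot> sigma z v c = u \<oplus> (\<ominus> (a \<odot> b \<odot> z) \<oplus> a \<odot> b \<odot> c \<odot> z)"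
    unfolding sigma_def by (simp add: skew_brace_simps assms uv' del: uv)
  also have "\<dots> = sigma z a (b \<odot> c)"
    unfolding uv(1) sigma_def by (simp add: skew_brace_simps assms)
  finally show ?thesis .
qed

lemma sigma_sigma_distributor:
  assumes "mul.src a = e" "mul.src b = e" "mul.src c = e" "mul.src z = e"
    and "z \<in> right_distributor"
  shows "sigma z a (sigma z b c) = \<ominus> (a \<odot> b \<odot> z \<odot> z) \<oplus> a \<odot> b \<odot> c \<odot> z \<odot> z"
proof -
  have add_z: "(x \<oplus> y) \<odot> z = x \<odot> z \<oplus> (\<ominus> z \<oplus> y \<odot> z)" for x y
    using assms(5) by (simp add: right_distributor_def add.assoc)
  have neg_z: "\<ominus> x \<odot> z = z \<oplus> (\<ominus> (x \<odot> z) \<oplus> z)" if "mul.src x = e" for x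
  proof -
    \<comment> \<open>Expanding the neutral element times \<open>z\<close> determines
      \<open>\<ominus> x \<odot> z\<close>.\<close>
    have "z = (x \<oplus> \<ominus> x) \<odot> z" using that assms by (simp add: mul.neutral_left)
    then have "\<ominus> (x \<odot> z) \<oplus> z = \<ominus> (x \<odot> z) \<oplus> (x \<odot> z \<oplus> (\<ominus> z \<oplus> \<ominus> x \<odot> z))"
      unfolding add_z by simp
    then show ?thesis using that assms by (simp add: skew_brace_simps)
  qed
  show ?thesis
    unfolding sigma_def by (simp add: skew_brace_simps assms add_z neg_z)
qed

lemma yang_baxter_components:
  assumes src: "mul.src a = e" "mul.src b = e" "mul.src c = e" "mul.src z = e"
    and z: "z \<in> right_distributor"
  shows "sigma z (sigma z a b) (sigma z (tau z b a) c) = sigma z a (sigma z b c)" (is ?first)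
    and "tau z (sigma z (tau z b a) c) (sigma z a b) =
      sigma z (tau z (sigma z b c) a) (tau z c b)" (is ?second)
    and "tau z c (tau z b a) = tau z (tau z c b) (tau z (sigma z b c) a)" (is ?third)
proof -
  \<comment> \<open>The two paths are \<open>(a, b, c)\<close>, \<open>(u, v, c)\<close>,
    \<open>(u, s, t)\<close> and \<open>(a, b, c)\<close>, \<open>(a, x, y)\<close>,
    \<open>(sigma z a x, p, y)\<close>, each followed by one last application of the map;
    \<open>q\<close> is the middle entry at the end of the second path.\<close>
  define u v s t x y p q where "u = sigma z a b" and "v = tau z b a"
    and "s = sigma z v c" and "t = tau z c v" and "x = sigma z b c" and "y = tau z c b"
    and "p = tau z x a" and "q = sigma z p y"
  note defs = u_def v_def s_def t_def x_def y_def p_def q_def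
  have srcs: "mul.src u = e" "mul.src v = e" "mul.src s = e" "mul.src t = e"
    "mul.src x = e" "mul.src y = e" "mul.src p = e" "mul.src q = e"
    by (simp_all add: defs src ee)
  have uv: "u \<odot> v = a \<odot> b" and st: "s \<odot> t = v \<odot> c" and xy: "x \<odot> y = b \<odot> c"
    and ap: "sigma z a x \<odot> p = a \<odot> x" and pq: "q \<odot> tau z y p = p \<odot> y"
    unfolding defs by (rule sigma_mul_tau; simp add: src ee)+
  \<comment> \<open>The closed form for a distributor element sees \<open>a\<close> and
    \<open>b\<close> only through their product, which equals \<open>u \<odot> v\<close>.\<close>
  have first: "sigma z u s = sigma z a x"
    unfolding s_def x_def using src srcs z uv
    by (simp add: sigma_sigma_distributor)
  have "u \<odot> s = sigma z a (b \<odot> c)"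
    unfolding s_def by (rule sigma_mul_sigma) (simp_all add: src srcs uv u_def[symmetric])
  moreover have "sigma z a x \<odot> q = sigma z a (x \<odot> y)"
    unfolding q_def by (rule sigma_mul_sigma) (simp_all add: src srcs ap ee)
  ultimately have us: "u \<odot> s = sigma z u s \<odot> q" by (simp add: xy first)
  have second: "tau z s u = q"
    unfolding tau_def by (simp add: us mul.assoc mul.cancel_left src srcs ee)
  \<comment> \<open>Each application of the map preserves the product of the triple. Both final
    triples thus have product \<open>a \<odot> b \<odot> c\<close>, and agreement in two entries
    forces agreement in the third.\<close>
  have "q \<odot> t = q \<odot> tau z y p"
  proof -
    have "sigma z a x \<odot> (q \<odot> t) = u \<odot> s \<odot> t" by (simp add: us first mul.assoc)
    also have "\<dots> = a \<odot> (b \<odot> c)" by (metis mul.assoc st uv)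
    also have "\<dots> = sigma z a x \<odot> (q \<odot> tau z y p)" by (metis mul.assoc ap pq xy)
    finally have "(sigma z a x)\<^sup>- \<odot> (sigma z a x \<odot> (q \<odot> t)) =
        (sigma z a x)\<^sup>- \<odot> (sigma z a x \<odot> (q \<odot> tau z y p))" by simp
    then show ?thesis by (simp add: mul.cancel_left src srcs ee)
  qed
  then have "q\<^sup>- \<odot> (q \<odot> t) = q\<^sup>- \<odot> (q \<odot> tau z y p)" by simp
  then have third: "t = tau z y p" by (simp add: mul.cancel_left src srcs ee)
  show ?first ?second ?third
    using first second third unfolding defs by simp_all
qed

lemma distributor_of_sigma_commute:
  assumes src: "mul.src w = e" "mul.src s = e" "mul.src z = e"
    and comm: "\<And>c. mul.src c = e \<Longrightarrow> sigma z e (sigma z w c) = sigma z w (sigma z e c)"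
  shows "(w \<oplus> s) \<odot> z = w \<odot> z \<oplus> (\<ominus> z \<oplus> s \<odot> z)"
proof -
  \<comment> \<open>This \<open>c\<close> solves \<open>sigma z w c = s\<close>, that is,
    \<open>w \<odot> c \<odot> z = w \<odot> z \<oplus> s\<close>.\<close>
  define c where "c = w\<^sup>- \<odot> (w \<odot> z \<oplus> s) \<odot> z\<^sup>-"
  have c: "mul.src c = e" by (simp add: c_def src ee)
  have cz: "c \<odot> z = w\<^sup>- \<odot> (w \<odot> z \<oplus> s)"
    by (simp add: c_def mul.assoc mul.neutral_right src ee)
  have wcz: "w \<odot> (c \<odot> z) = w \<odot> z \<oplus> s"
    unfolding cz by (simp add: mul.cancel_left src ee)
  have "sigma z w c = s"
    unfolding sigma_def by (simp add: wcz mul.assoc add.cancel_left src ee)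
  then have l: "sigma z e (sigma z w c) = \<ominus> z \<oplus> s \<odot> z"
    unfolding sigma_def by (simp add: mul.neutral_left src ee)
  have "w \<odot> sigma z e c = w \<oplus> s"
    unfolding sigma_def by (simp add: wcz skew_brace_simps src c)
  then have "sigma z w (sigma z e c) = \<ominus> (w \<odot> z) \<oplus> (w \<oplus> s) \<odot> z"
    unfolding sigma_def[of z w "sigma z e c"] by simp
  with l comm[OF c] have "w \<odot> z \<oplus> (\<ominus> z \<oplus> s \<odot> z) = w \<odot> z \<oplus> (\<ominus> (w \<odot> z) \<oplus> (w \<oplus> s) \<odot> z)"
    by simp
  then show ?thesis by (simp add: add.cancel_left src ee)
qed

end

section \<open>Transfer from the skew braces to the whole brace\<close>

lemma eqI_src_mul:
  assumes "mul.src x = mul.src e" "mul.src y = mul.src e" "mul.src e \<odot> x = mul.src e \<odot> y"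
  shows "x = y"
  using assms by (metis mul.src_mult_self)

lemma yang_baxter_of_right_distributor:
  assumes z: "z \<in> right_distributor"
  shows "yang_baxter_solution (deformed_map z)"
  unfolding yang_baxter_deformed_map_iff
proof (intro allI)
  fix a b c
  \<comment> \<open>Both sides of each component equation have source \<open>mul.src g\<close>, so
    multiplying by it loses nothing and moves all variables into one skew brace.\<close>
  define g where "g = a \<odot> b \<odot> c \<odot> z"
  let ?e = "mul.src g"
  have src: "mul.src (?e \<odot> a) = ?e" "mul.src (?e \<odot> b) = ?e"
    "mul.src (?e \<odot> c) = ?e" "mul.src (?e \<odot> z) = ?e"
    by (simp_all add: g_def mul.assoc mul.src_ac)
  note components = yang_baxter_components[OF mul.src_idem src src_mul_right_distributor[OF z]]
  show "sigma z (sigma z a b) (sigma z (tau z b a) c) = sigma z a (sigma z b c) \<and>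
      tau z (sigma z (tau z b a) c) (sigma z a b) =
        sigma z (tau z (sigma z b c) a) (tau z c b) \<and>
      tau z c (tau z b a) = tau z (tau z c b) (tau z (sigma z b c) a)"
    by (intro conjI; rule eqI_src_mul[of _ g];
        (simp only: src_mul_sigma src_mul_tau components
          | simp add: g_def mul.assoc mul.src_ac))
qed

lemma right_distributor_of_yang_baxter:
  assumes "yang_baxter_solution (deformed_map z)"
  shows "z \<in> right_distributor"
  unfolding right_distributor_def
proof (intro CollectI allI)
  fix a b
  define g where "g = a \<odot> b \<odot> z"
  let ?e = "mul.src g"
  let ?z = "?e \<odot> z" and ?w = "?e \<odot> a" and ?s = "?e \<odot> b"
  have src: "mul.src ?w = ?e" "mul.src ?s = ?e" "mul.src ?z = ?e"
    by (simp_all add: g_def mul.assoc mul.src_ac)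
  have "sigma ?z ?e (sigma ?z ?w c) = sigma ?z ?w (sigma ?z ?e c)" if c: "mul.src c = ?e" for c
  proof -
    \<comment> \<open>This is the first Yang-Baxter component at \<open>(?w, ?e, c)\<close>.
      Multiplying by \<open>?e\<close> replaces \<open>z\<close> by \<open>?z\<close>, after which
      the map sends \<open>(?w, ?e)\<close> to \<open>(?e, ?w)\<close>.\<close>
    have "?e \<odot> sigma z (sigma z ?w ?e) (sigma z (tau z ?e ?w) c) =
        ?e \<odot> sigma z ?w (sigma z ?e c)"
      using assms by (simp add: yang_baxter_deformed_map_iff)
    moreover have "?e \<odot> ?w = ?w" "?e \<odot> c = c"
      by (rule mul.neutral_left, rule src c)+
    ultimately have "sigma ?z (sigma ?z ?w ?e) (sigma ?z (tau ?z ?e ?w) c) =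
        sigma ?z ?w (sigma ?z ?e c)"
      by (simp only: src_mul_sigma src_mul_tau mul.src_idem)
    moreover have "sigma ?z ?w ?e = ?e" "tau ?z ?e ?w = ?w"
      by (rule sigma_neutral tau_neutral, rule mul.src_idem, rule src, rule src)+
    ultimately show ?thesis by simp
  qed
  note distrib = distributor_of_sigma_commute[OF mul.src_idem src this]
  show "(a \<oplus> b) \<odot> z = a \<odot> z \<oplus> \<ominus> z \<oplus> b \<odot> z"
  proof (rule eqI_src_mul[of _ g])
    show "?e \<odot> ((a \<oplus> b) \<odot> z) = ?e \<odot> (a \<odot> z \<oplus> \<ominus> z \<oplus> b \<odot> z)"
      using distrib by (simp only: src_mul_add src_mul_neg src_mul_mul add.assoc)
  qed (simp_all add: g_def mul.assoc mul.src_ac)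
qed

end

theorem theorem2p9:
  fixes add mul :: "'a \<Rightarrow> 'a \<Rightarrow> 'a" and z :: 'a
  assumes "dual_weak_brace add mul"
  shows "yang_baxter_solution (weak_brace.deformed_map add mul z)
    \<longleftrightarrow> z \<in> weak_brace.right_distributor add mul"
proof -
  interpret dual_weak_brace add mul by (fact assms)
  show ?thesis
    using yang_baxter_of_right_distributor right_distributor_of_yang_baxter by blast
qed

end
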